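(* Let $\mathbb{K}^2$ be the Klein bottle, and let $u,v\in P_2(\mathbb{K}^2)$, the section $\varphi$, the action $\theta$ and the isomorphisms $\lambda,\gamma$ be as in the context. The homomorphism $\theta:\mathbb{Z}\rtimes\mathbb{Z}\to\mathrm{Aut}(F(u,v))$ is given, for all $(m,n)\in\mathbb{Z}\rtimes\mathbb{Z}$, by $$\theta(m,n):\quad u\mapsto B^{m-\delta_n}u^{(-1)^n}B^{-m+\delta_n},\qquad v\mapsto B^mvu^{-2m}B^{-m+\delta_n},\qquad B\mapsto B^{(-1)^n},$$ where $B=[u,v]'=uvuv^{-1}$, and $\delta_n=0$ if $n$ is even and $\delta_n=1$ if $n$ is odd. The mutually inverse isomorphisms $\lambda:F(u,v)\rtimes_\theta(\mathbb{Z}\rtimes\mathbb{Z})\to P_2(\mathbb{K}^2)$ and $\gamma:P_2(\mathbb{K}^2)\to F(u,v)\rtimes_\theta(\mathbb{Z}\rtimes\mathbb{Z})$ are given by $$\lambda:\ (u;0,0)\mapsto b_1b_2,\quad (v;0,0)\mapsto b_2^{-1},\quad (B;0,0)\mapsto B,\quad (\mathbb{1};1,0)\mapsto b_1a_1b_2a_2,\quad (\mathbb{1};0,1)\mapsto a_2^{-1}b_2^{-1},$$ $$\gamma:\ a_1\mapsto(v^{-1}u^{-1};1,1),\quad a_2\mapsto(v;0,-1),\quad b_1\mapsto(uv;0,0),\quad b_2\mapsto(v^{-1};0,0),\quad B\mapsto(B;0,0).$$ Up to these isomorphisms and the identification $\pi_1(\mathbb{K}^2)=\mathbb{Z}\rtimes\mathbb{Z}$,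 the homomorphism $(p_1)_\#:P_2(\mathbb{K}^2)\to\pi_1(\mathbb{K}^2)$ is the projection onto the second coordinate, in other words, $(p_1)_\#(w;m,n)=(m,n)$.
   Context: $P_2(\mathbb{K}^2)=\pi_1(F_2(\mathbb{K}^2))$ is the pure $2$-string braid group, where $F_2(\mathbb{K}^2)=\{(y_1,y_2)\in\mathbb{K}^2\times\mathbb{K}^2\mid y_1\ne y_2\}$, and $p_1:F_2(\mathbb{K}^2)\to\mathbb{K}^2$ is projection onto the first coordinate. $P_2(\mathbb{K}^2)$ is presented by generators $a_1,a_2,b_1,b_2,B$ and relations: $b_ra_r=Ba_rB^{-1}b_rB$ and $[a_r,b_r]=a_rBa_r^{-1}$ for $r\in\{1,2\}$; $b_1Ba_2B^{-1}=Ba_2B^{-1}b_1$; $[a_1,b_2]=1$; $a_1^2a_2^2=b_1^2b_2^2=B$, where $[a,b]=aba^{-1}b^{-1}$. The group $\mathbb{Z}\rtimes\mathbb{Z}$ is the set $\mathbb{Z}\times\mathbb{Z}$ with product $(r_1,s_1)(r_2,s_2)=(r_1+(-1)^{s_1}r_2,s_1+s_2)$. Identify $\pi_1(\mathbb{K}^2)$ with $\mathbb{Z}\rtimes\mathbb{Z}$ so that $(p_1)_\#(a_1)=(1,1)$ and $(p_1)_\#(a_2)=(0,-1)$; moreover $(p_1)_\#(b_1)=(p_1)_\#(b_2)=(0,0)$, and $\ker(p_1)_\#$ is the free group on $\{b_1,b_2\}$. Put $u=b_1b_2$ and $v=b_2^{-1}$, so $\ker(p_1)_\#=F(u,v)$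 is free on $\{u,v\}$. The trivial element of $F(u,v)$ is denoted $\mathbb{1}$, and $[a,b]'=abab^{-1}$. The homomorphism $\varphi:\mathbb{Z}\rtimes\mathbb{Z}\to P_2(\mathbb{K}^2)$ with $\varphi(1,0)=b_1a_1b_2a_2$ and $\varphi(0,1)=a_2^{-1}b_2^{-1}$ is a section of $(p_1)_\#$. The action $\theta$ is defined by $\theta(m,n)(w)=\varphi(m,n)\,w\,\varphi(m,n)^{-1}$. Elements of $F(u,v)\rtimes_\theta(\mathbb{Z}\rtimes\mathbb{Z})$ are written $(w;m,n)$, with product $(w;g)(w';g')=(w\,\theta(g)(w');gg')$. The isomorphisms are $\lambda(w;m,n)=w\,\varphi(m,n)$ and $\gamma(g)=(g\,\varphi((p_1)_\#(g))^{-1};(p_1)_\#(g))$. *)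

theory Defs
  imports "HOL-Analysis.Analysis" "HOL-Algebra.Coset" "HOL-Algebra.Bij"
begin

section \<open>The Klein bottle and its configuration space\<close>

text \<open>
  The Klein bottle is the orbit space of the plane under the maps
  $(x, y) \mapsto ((-1)^n x + m, y + n)$ for integers $m$, $n$.
\<close>

definition alt_sign :: "int \<Rightarrow> int" where
  "alt_sign n = (- 1) ^ nat \<bar>n\<bar>"

lemma alt_sign_eq: "alt_sign n = (if even n then 1 else - 1)"
  by (simp add: alt_sign_def even_nat_iff)

definition klein_rel :: "real \<times> real \<Rightarrow> real \<times> real \<Rightarrow> bool" where
  "klein_rel z w \<longleftrightarrow>
     (\<exists>m n :: int. w = (of_int (alt_sign n) * fst z + of_int m, snd z + of_int n))"

lemma equivp_klein_rel: "equivp klein_rel"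
proof (rule equivpI)
  show "reflp klein_rel"
  proof (rule reflpI)
    fix z :: "real \<times> real"
    have "z = (of_int (alt_sign 0) * fst z + of_int 0, snd z + of_int 0)"
      by (simp add: alt_sign_eq)
    then show "klein_rel z z" unfolding klein_rel_def by blast
  qed
  show "symp klein_rel"
  proof (rule sympI)
    fix z w assume "klein_rel z w"
    then obtain m n :: int
      where w: "w = (of_int (alt_sign n) * fst z + of_int m, snd z + of_int n)"
      by (auto simp: klein_rel_def)
    have "z = (of_int (alt_sign (- n)) * fst w + of_int (- alt_sign n * m), snd w + of_int (- n))"
      by (cases z) (auto simp: w alt_sign_eq)
    then show "klein_rel w z" unfolding klein_rel_def by blast
  qed
  show "transp klein_rel"
  proof (rule transpI)
    fix z w t assume "klein_rel z w" "klein_rel w t"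
    then obtain m n m' n' :: int
      where w: "w = (of_int (alt_sign n) * fst z + of_int m, snd z + of_int n)"
        and t: "t = (of_int (alt_sign n') * fst w + of_int m', snd w + of_int n')"
      by (auto simp: klein_rel_def)
    have "t = (of_int (alt_sign (n' + n)) * fst z + of_int (m' + alt_sign n' * m),
               snd z + of_int (n' + n))"
      by (auto simp: t w alt_sign_eq)
    then show "klein_rel z t" unfolding klein_rel_def by blast
  qed
qed

quotient_type klein_bottle = "real \<times> real" / klein_rel
  by (rule equivp_klein_rel)

instantiation klein_bottle :: topological_space
begin

definition open_klein_bottle :: "klein_bottle set \<Rightarrow> bool" where
  "open_klein_bottle U \<longleftrightarrow> open (abs_klein_bottle -` U)"

instance
proof
  show "open (UNIV :: klein_bottle set)"
    by (simp add: open_klein_bottle_def)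
next
  fix S T :: "klein_bottle set" assume "open S" "open T"
  then show "open (S \<inter> T)" by (simp add: open_klein_bottle_def open_Int)
next
  fix K :: "klein_bottle set set" assume "\<forall>S\<in>K. open S"
  then show "open (\<Union>K)" by (auto simp: open_klein_bottle_def vimage_Union intro: open_UN)
qed

end

definition ordered_config2 :: "('a \<times> 'a) set" where
  "ordered_config2 = {(y, z). y \<noteq> z}"

section \<open>Fundamental groups\<close>

text \<open>
  Only the values of a path on the unit interval matter: paths agreeing there are
  identified by the library relation \<^const>\<open>homotopic_paths\<close>.
  The product of two classes is that of the path running through the first loop first.
\<close>

definition loops_at :: "'a::topological_space set \<Rightarrow> 'a \<Rightarrow> (real \<Rightarrow> 'a) set" where
  "loops_at S x = {g. path g \<and> path_image g \<subseteq> S \<and> pathstart g = x \<and> pathfinish g = x}"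

definition path_class :: "'a::topological_space set \<Rightarrow> (real \<Rightarrow> 'a) \<Rightarrow> (real \<Rightarrow> 'a) set" where
  "path_class S g = {h. homotopic_paths S g h}"

definition fundamental_group :: "'a::topological_space set \<Rightarrow> 'a \<Rightarrow> (real \<Rightarrow> 'a) set monoid" where
  "fundamental_group S x =
     \<lparr>carrier = path_class S ` loops_at S x,
      mult = (\<lambda>X Y. \<Union>g\<in>X. \<Union>h\<in>Y. path_class S (g +++ h)),
      one = path_class S (\<lambda>_. x)\<rparr>"

definition induced_map ::
    "'b::topological_space set \<Rightarrow> ('a::topological_space \<Rightarrow> 'b) \<Rightarrow> (real \<Rightarrow> 'a) set \<Rightarrow> (real \<Rightarrow> 'b) set" where
  "induced_map T f X = (\<Union>g\<in>X. path_class T (f \<circ> g))"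

lemma path_class_eq_iff:
  assumes "path g" "path_image g \<subseteq> S"
  shows "path_class S g = path_class S h \<longleftrightarrow> homotopic_paths S g h"
proof
  assume "path_class S g = path_class S h"
  moreover have "g \<in> path_class S g" using assms by (simp add: path_class_def)
  ultimately have "homotopic_paths S h g" by (simp add: path_class_def)
  then show "homotopic_paths S g h" by (rule homotopic_paths_sym)
next
  assume gh: "homotopic_paths S g h"
  have "homotopic_paths S g k \<longleftrightarrow> homotopic_paths S h k" for k
    using homotopic_paths_trans [OF gh] homotopic_paths_trans [OF homotopic_paths_sym [OF gh]] by blast
  then show "path_class S g = path_class S h" by (simp add: path_class_def)
qed

lemma path_class_refl: "g \<in> loops_at S x \<Longrightarrow> g \<in> path_class S g"
  by (simp add: loops_at_def path_class_def)

lemma path_class_mult: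
  assumes g: "g \<in> loops_at S x" and h: "h \<in> loops_at S x"
  shows "path_class S g \<otimes>\<^bsub>fundamental_group S x\<^esub> path_class S h = path_class S (g +++ h)"
proof -
  have gh: "path (g +++ h)" "path_image (g +++ h) \<subseteq> S"
    using g h by (auto simp: loops_at_def path_image_join)
  have *: "path_class S (g' +++ h') = path_class S (g +++ h)"
    if "g' \<in> path_class S g" "h' \<in> path_class S h" for g' h'
  proof -
    have "homotopic_paths S (g +++ h) (g' +++ h')"
      using that g h by (intro homotopic_paths_join) (auto simp: path_class_def loops_at_def)
    then show ?thesis using path_class_eq_iff [OF gh, of "g' +++ h'"] by simp
  qed
  have "(\<Union>g'\<in>path_class S g. \<Union>h'\<in>path_class S h. path_class S (g' +++ h')) =
      (\<Union>g'\<in>path_class S g. \<Union>h'\<in>path_class S h. path_class S (g +++ h))"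
    by (intro SUP_cong refl *)
  also have "\<dots> = path_class S (g +++ h)"
    using path_class_refl [OF g] path_class_refl [OF h] by blast
  finally show ?thesis by (simp add: fundamental_group_def)
qed

lemma induced_map_class:
  assumes g: "g \<in> loops_at S x" and f: "continuous_on S f" "f ` S \<subseteq> T"
  shows "induced_map T f (path_class S g) = path_class T (f \<circ> g)"
proof -
  have *: "homotopic_paths T (f \<circ> g) (f \<circ> g')" if "g' \<in> path_class S g" for g'
    using that f by (intro homotopic_paths_continuous_image [of S]) (auto simp: path_class_def)
  then have **: "path_class T (f \<circ> g') = path_class T (f \<circ> g)" if "g' \<in> path_class S g" for g'
    using that path_class_eq_iff homotopic_paths_imp_path homotopic_paths_imp_subset by metis
  have "induced_map T f (path_class S g) = (\<Union>g'\<in>path_class S g. path_class T (f \<circ> g))"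
    unfolding induced_map_def by (intro SUP_cong refl **)
  then show ?thesis using path_class_refl [OF g] by blast
qed

lemma loops_at_const: "x \<in> S \<Longrightarrow> (\<lambda>_. x) \<in> loops_at S x"
  by (auto simp: loops_at_def path_def path_image_def pathstart_def pathfinish_def)

lemma loops_at_join: "g \<in> loops_at S x \<Longrightarrow> h \<in> loops_at S x \<Longrightarrow> g +++ h \<in> loops_at S x"
  by (auto simp: loops_at_def path_image_join)

lemma loops_at_reverse: "g \<in> loops_at S x \<Longrightarrow> reversepath g \<in> loops_at S x"
  by (auto simp: loops_at_def)

text \<open>
  The library states the unit and inverse laws for \<^const>\<open>homotopic_paths\<close> in normed
  spaces only; the general case is the image of these laws for the unit interval.
\<close>

lemma homotopic_loops_at:
  assumes g: "g \<in> loops_at S x"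
  shows "homotopic_paths S ((\<lambda>_. x) +++ g) g"
    and "homotopic_paths S (reversepath g +++ g) (\<lambda>_. x)"
proof -
  have cont: "continuous_on {0..1::real} g" and into: "g \<in> {0..1} \<rightarrow> S"
    and ends: "g 0 = x" "g 1 = x"
    using g by (auto simp: loops_at_def path_def path_image_def pathstart_def pathfinish_def)
  let ?i = "linepath (0::real) 1"
  have i: "path ?i" "path_image ?i \<subseteq> {0..1}" by (auto simp: closed_segment_eq_real_ivl)
  have i_id: "?i = (\<lambda>t. t)" by (auto simp: linepath_def)
  have "homotopic_paths {0..1} (linepath 0 0 +++ ?i) ?i"
    using homotopic_paths_lid [OF i] by simp
  from homotopic_paths_continuous_image [OF this cont into]
  have "homotopic_paths S (g \<circ> (linepath 0 0 +++ ?i)) (g \<circ> ?i)" .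
  moreover have "g \<circ> (linepath 0 0 +++ ?i) = (\<lambda>_. x) +++ g"
    by (auto simp: fun_eq_iff joinpaths_def i_id ends linepath_def)
  moreover have "g \<circ> ?i = g" by (simp add: i_id fun_eq_iff)
  ultimately show "homotopic_paths S ((\<lambda>_. x) +++ g) g" by (simp only:)
  have "homotopic_paths {0..1} (reversepath ?i +++ ?i) (linepath 1 1)"
    using homotopic_paths_linv [OF i] by simp
  from homotopic_paths_continuous_image [OF this cont into]
  have "homotopic_paths S (g \<circ> (reversepath ?i +++ ?i)) (g \<circ> linepath 1 1)" .
  moreover have "g \<circ> (reversepath ?i +++ ?i) = reversepath g +++ g"
    by (auto simp: fun_eq_iff joinpaths_def reversepath_def linepath_def)
  moreover have "g \<circ> linepath 1 1 = (\<lambda>_. x)"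
    by (auto simp: fun_eq_iff ends linepath_def algebra_simps)
  ultimately show "homotopic_paths S (reversepath g +++ g) (\<lambda>_. x)" by (simp only:)
qed

lemma path_class_loops_eqI:
  assumes "g \<in> loops_at S x" "homotopic_paths S g h"
  shows "path_class S g = path_class S h"
  using assms path_class_eq_iff by (auto simp: loops_at_def)

theorem group_fundamental_group:
  assumes x: "x \<in> S"
  shows "group (fundamental_group S x)"
proof -
  let ?G = "fundamental_group S x"
  have car: "carrier ?G = path_class S ` loops_at S x"
    and one: "\<one>\<^bsub>?G\<^esub> = path_class S (\<lambda>_. x)"
    by (simp_all add: fundamental_group_def)
  show ?thesis
  proof (rule groupI)
    fix X Y assume "X \<in> carrier ?G" "Y \<in> carrier ?G"
    then show "X \<otimes>\<^bsub>?G\<^esub> Y \<in> carrier ?G"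
      by (auto simp: car path_class_mult loops_at_join)
  next
    show "\<one>\<^bsub>?G\<^esub> \<in> carrier ?G" using loops_at_const [OF x] by (auto simp: car one)
  next
    fix X Y Z assume "X \<in> carrier ?G" "Y \<in> carrier ?G" "Z \<in> carrier ?G"
    then obtain g h k where
      X: "X = path_class S g" "g \<in> loops_at S x" and
      Y: "Y = path_class S h" "h \<in> loops_at S x" and
      Z: "Z = path_class S k" "k \<in> loops_at S x"
      by (auto simp: car)
    have "homotopic_paths S (g +++ (h +++ k)) ((g +++ h) +++ k)"
      using X(2) Y(2) Z(2) by (intro homotopic_paths_assoc) (auto simp: loops_at_def)
    then have "path_class S (g +++ (h +++ k)) = path_class S ((g +++ h) +++ k)"
      using X(2) Y(2) Z(2) by (intro path_class_loops_eqI loops_at_join)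
    then show "X \<otimes>\<^bsub>?G\<^esub> Y \<otimes>\<^bsub>?G\<^esub> Z = X \<otimes>\<^bsub>?G\<^esub> (Y \<otimes>\<^bsub>?G\<^esub> Z)"
      using X Y Z by (simp add: path_class_mult loops_at_join)
  next
    fix X assume "X \<in> carrier ?G"
    then obtain g where X: "X = path_class S g" "g \<in> loops_at S x" by (auto simp: car)
    note c = loops_at_const [OF x] and r = loops_at_reverse [OF X(2)]
    show "\<one>\<^bsub>?G\<^esub> \<otimes>\<^bsub>?G\<^esub> X = X"
      using path_class_loops_eqI [OF loops_at_join [OF c X(2)] homotopic_loops_at(1) [OF X(2)]]
      by (simp add: one X path_class_mult [OF c X(2)])
    have "path_class S (reversepath g) \<otimes>\<^bsub>?G\<^esub> X = \<one>\<^bsub>?G\<^esub>"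
      using path_class_loops_eqI [OF loops_at_join [OF r X(2)] homotopic_loops_at(2) [OF X(2)]]
      by (simp add: one X path_class_mult [OF r X(2)])
    then show "\<exists>Y\<in>carrier ?G. Y \<otimes>\<^bsub>?G\<^esub> X = \<one>\<^bsub>?G\<^esub>" using r by (auto simp: car)
  qed
qed

lemma induced_map_hom:
  assumes "continuous_on S f" "f ` S \<subseteq> T"
  shows "induced_map T f \<in> hom (fundamental_group S x) (fundamental_group T (f x))"
proof -
  have loop: "f \<circ> g \<in> loops_at T (f x)" if g: "g \<in> loops_at S x" for g
  proof -
    have "path (f \<circ> g)"
      using g continuous_on_subset [OF assms(1)]
      by (intro path_continuous_image) (auto simp: loops_at_def)
    then show ?thesis
      using g assms(2)
      by (auto simp: loops_at_def path_image_compose pathstart_compose pathfinish_compose)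
  qed
  show ?thesis
  proof (rule homI)
    fix X assume "X \<in> carrier (fundamental_group S x)"
    then show "induced_map T f X \<in> carrier (fundamental_group T (f x))"
      using loop by (auto simp: fundamental_group_def induced_map_class [OF _ assms])
  next
    fix X Y assume "X \<in> carrier (fundamental_group S x)" "Y \<in> carrier (fundamental_group S x)"
    then obtain g h where
      X: "X = path_class S g" "g \<in> loops_at S x" and Y: "Y = path_class S h" "h \<in> loops_at S x"
      by (auto simp: fundamental_group_def)
    from X Y show "induced_map T f (X \<otimes>\<^bsub>fundamental_group S x\<^esub> Y) =
        induced_map T f X \<otimes>\<^bsub>fundamental_group T (f x)\<^esub> induced_map T f Y"
      by (simp add: path_class_mult loop induced_map_class [OF X(2) assms]
          induced_map_class [OF Y(2) assms] induced_map_class [OF loops_at_join [OF X(2) Y(2)] assms]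
          path_compose_join)
  qed
qed

section \<open>Group presentations\<close>

text \<open>In a word, the letter \<open>(x, True)\<close> is the generator \<open>x\<close> and \<open>(x, False)\<close> its inverse.\<close>

type_synonym 'x word = "('x \<times> bool) list"

abbreviation gen :: "'x \<Rightarrow> 'x word" where
  "gen x \<equiv> [(x, True)]"

definition word_inv :: "'x word \<Rightarrow> 'x word" where
  "word_inv w = rev (map (\<lambda>(x, s). (x, \<not> s)) w)"

inductive word_equiv :: "('x word \<times> 'x word) set \<Rightarrow> 'x word \<Rightarrow> 'x word \<Rightarrow> bool"
  for R :: "('x word \<times> 'x word) set" where
  refl: "word_equiv R w w"
| sym: "word_equiv R w w' \<Longrightarrow> word_equiv R w' w"
| trans: "word_equiv R w w' \<Longrightarrow> word_equiv R w' w'' \<Longrightarrow> word_equiv R w w''"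
| cancel: "word_equiv R (w @ [(x, s), (x, \<not> s)] @ w') (w @ w')"
| relation: "(l, r) \<in> R \<Longrightarrow> word_equiv R (w @ l @ w') (w @ r @ w')"

definition eval_word :: "('a, 'm) monoid_scheme \<Rightarrow> ('x \<Rightarrow> 'a) \<Rightarrow> 'x word \<Rightarrow> 'a" where
  "eval_word G g w =
     foldr (\<lambda>(x, s) y. (if s then g x else inv\<^bsub>G\<^esub> (g x)) \<otimes>\<^bsub>G\<^esub> y) w \<one>\<^bsub>G\<^esub>"

definition presented_by ::
    "('a, 'm) monoid_scheme \<Rightarrow> ('x \<Rightarrow> 'a) \<Rightarrow> ('x word \<times> 'x word) set \<Rightarrow> bool" where
  "presented_by G g R \<longleftrightarrow>
     group G \<and> range g \<subseteq> carrier G \<and> carrier G = range (eval_word G g) \<and>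
     (\<forall>w w'. eval_word G g w = eval_word G g w' \<longleftrightarrow> word_equiv R w w')"

definition free_on :: "('a, 'm) monoid_scheme \<Rightarrow> ('x \<Rightarrow> 'a) \<Rightarrow> bool" where
  "free_on G g \<longleftrightarrow> presented_by G g {}"

section \<open>The braid relations and the semidirect products\<close>

datatype braid_gen = Ga1 | Ga2 | Gb1 | Gb2 | GB

definition word_comm :: "'x word \<Rightarrow> 'x word \<Rightarrow> 'x word" where
  "word_comm a b = a @ b @ word_inv a @ word_inv b"

definition klein_braid_relations :: "(braid_gen word \<times> braid_gen word) set" where
  "klein_braid_relations =
     (let a1 = gen Ga1; a2 = gen Ga2; b1 = gen Gb1; b2 = gen Gb2; B = gen GB; B' = word_inv B in
      (\<Union>(a, b) \<in> {(a1, b1), (a2, b2)}.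
         {(b @ a, B @ a @ B' @ b @ B),
          (word_comm a b, a @ B @ word_inv a)}) \<union>
      {(b1 @ B @ a2 @ B', B @ a2 @ B' @ b1),
       (word_comm a1 b2, []),
       (a1 @ a1 @ a2 @ a2, b1 @ b1 @ b2 @ b2),
       (b1 @ b1 @ b2 @ b2, B)})"

definition int_sdprod :: "(int \<times> int) monoid" where
  "int_sdprod =
     \<lparr>carrier = UNIV,
      mult = (\<lambda>(r1, s1) (r2, s2). (r1 + alt_sign s1 * r2, s1 + s2)),
      one = (0, 0)\<rparr>"

definition sdprod ::
    "('a, 'm) monoid_scheme \<Rightarrow> ('b, 'n) monoid_scheme \<Rightarrow> ('b \<Rightarrow> 'a \<Rightarrow> 'a) \<Rightarrow> ('a \<times> 'b) monoid" where
  "sdprod N H \<theta> =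
     \<lparr>carrier = carrier N \<times> carrier H,
      mult = (\<lambda>(w, g) (w', g'). (w \<otimes>\<^bsub>N\<^esub> \<theta> g w', g \<otimes>\<^bsub>H\<^esub> g')),
      one = (\<one>\<^bsub>N\<^esub>, \<one>\<^bsub>H\<^esub>)\<rparr>"

definition odd_delta :: "int \<Rightarrow> int" where
  "odd_delta n = (if even n then 0 else 1)"

end

theory Submission
  imports Defs "HOL-Algebra.Elementary_Groups"
begin

text \<open>
  The projection of the pure braid group onto the group of the Klein bottle is a split
  surjection, and for every split surjection the group is the semidirect product of the kernel
  by the section (\<open>split_extension.semidirect_isomorphisms\<close>). This yields \<open>\<lambda>\<close>, \<open>\<gamma>\<close> and
  \<open>\<theta>\<close>; topology enters only through the fact that the projection of configurations induces a
  homomorphism of fundamental groups. The values of \<open>\<lambda>\<close> and \<open>\<gamma>\<close> on generators then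
  follow from $\varphi(1,1) = b_1 a_1$ and $\varphi(0,-1) = b_2 a_2$.

  The formulas for \<open>\<theta>\<close> rest on the elements $c_r = b_r a_r$, with which
  $\varphi(1,0) = c_1 c_2$ and $\varphi(0,1) = c_2^{-1}$. The relations say in disguise that
  conjugation by either $c_r$ inverts $B$; from this one reads off the action of $c_1$ and $c_2$
  on $u$ and $v$ (\<open>handle_relations\<close>, \<open>klein_braid_conjugation\<close>):
  \[ c_1 : u \mapsto u^{-1},\ v \mapsto B v u^{-2}, \qquad
     c_2 : u \mapsto B^{-1} u^{-1} B,\ v \mapsto v B. \]

  To pass to powers no induction on $m$ and $n$ is needed (\<open>conjugate_klein_section\<close>). The
  action of $c_2$ is an involution, so only the parity of $n$ matters. And $x = c_1 c_2$ commutes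
  with $B$, so $x^m = B^m z^m$ where $z = B^{-1} x$ acts in a simpler way: it fixes $u$ and
  takes $v$ to $v u^{-2}$, whence $z^m$ takes $v$ to $v u^{-2m}$.

  Finally, $u = b_1 b_2$ and $v = b_2^{-1}$ form a basis of the kernel because the endomorphism
  taking $b_1$, $b_2$ to $u$, $v$ is its own inverse (\<open>free_on_product_basis\<close>).
\<close>

section \<open>Conjugation in a group\<close>

definition conjugate :: "('a, 'm) monoid_scheme \<Rightarrow> 'a \<Rightarrow> 'a \<Rightarrow> 'a" where
  "conjugate G x w = x \<otimes>\<^bsub>G\<^esub> w \<otimes>\<^bsub>G\<^esub> inv\<^bsub>G\<^esub> x"

context group
begin

lemma inv_mult_cancel [simp]:
  "x \<in> carrier G \<Longrightarrow> y \<in> carrier G \<Longrightarrow> inv x \<otimes> (x \<otimes> y) = y"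
  "x \<in> carrier G \<Longrightarrow> y \<in> carrier G \<Longrightarrow> x \<otimes> (inv x \<otimes> y) = y"
  by (simp_all flip: m_assoc)

lemma conjugate_closed [simp]:
  "x \<in> carrier G \<Longrightarrow> w \<in> carrier G \<Longrightarrow> conjugate G x w \<in> carrier G"
  by (simp add: conjugate_def)

lemma conjugate_hom: "x \<in> carrier G \<Longrightarrow> conjugate G x \<in> hom G G"
  by (rule homI) (simp_all add: conjugate_def m_assoc)

lemma conjugate_mult:
  "x \<in> carrier G \<Longrightarrow> v \<in> carrier G \<Longrightarrow> w \<in> carrier G \<Longrightarrow>
    conjugate G x (v \<otimes> w) = conjugate G x v \<otimes> conjugate G x w"
  by (simp add: hom_mult [OF conjugate_hom])

lemma conjugate_inv:
  "x \<in> carrier G \<Longrightarrow> w \<in> carrier G \<Longrightarrow> conjugate G x (inv w) = inv (conjugate G x w)"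
  by (simp add: conjugate_def inv_mult_group m_assoc)

lemma conjugate_int_pow:
  "x \<in> carrier G \<Longrightarrow> w \<in> carrier G \<Longrightarrow>
    conjugate G x (w [^] (k :: int)) = conjugate G x w [^] k"
  by (rule hom_int_pow [OF conjugate_hom]) (rule is_group | assumption)+

lemma conjugate_mult_left:
  "x \<in> carrier G \<Longrightarrow> y \<in> carrier G \<Longrightarrow> w \<in> carrier G \<Longrightarrow>
    conjugate G (x \<otimes> y) w = conjugate G x (conjugate G y w)"
  by (simp add: conjugate_def inv_mult_group m_assoc)

lemma conjugate_one [simp]: "w \<in> carrier G \<Longrightarrow> conjugate G \<one> w = w"
  by (simp add: conjugate_def)

lemma conjugate_inv_left:
  "x \<in> carrier G \<Longrightarrow> w \<in> carrier G \<Longrightarrow> conjugate G (inv x) (conjugate G x w) = w"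
  by (simp flip: conjugate_mult_left)

lemma conjugate_fixed_iff:
  "x \<in> carrier G \<Longrightarrow> w \<in> carrier G \<Longrightarrow> conjugate G x w = w \<longleftrightarrow> x \<otimes> w = w \<otimes> x"
  by (auto simp: conjugate_def inv_solve_right')

text \<open>
  Commuting is symmetric: conjugation by $w$ fixes $x$ and, being a homomorphism, also the powers
  of $x$.
\<close>

lemma conjugate_fixed_int_pow:
  assumes "x \<in> carrier G" "w \<in> carrier G" "conjugate G x w = w"
  shows "conjugate G (x [^] (k :: int)) w = w"
proof -
  have "conjugate G w x = x" using assms by (simp add: conjugate_fixed_iff)
  then have "conjugate G w (x [^] k) = x [^] k" using assms by (simp add: conjugate_int_pow)
  then show ?thesis using assms by (simp add: conjugate_fixed_iff)
qed

text \<open>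
  The hypothesis on $v$ is turned around: it says that conjugation by $v^{-1}$ takes $x$ to
  $s x$, and the powers of $s x$ are known since $s$ and $x$ commute.
\<close>

lemma conjugate_transvection_int_pow:
  assumes x: "x \<in> carrier G" and v: "v \<in> carrier G" and s: "s \<in> carrier G"
    and xs: "conjugate G x s = s" and xv: "conjugate G x v = v \<otimes> s"
  shows "conjugate G (x [^] (k :: int)) v = v \<otimes> s [^] k"
proof -
  have "x \<otimes> v = v \<otimes> s \<otimes> x" using xv x v s by (simp add: conjugate_def inv_solve_right')
  then have "conjugate G (inv v) x = s \<otimes> x" using x v s by (simp add: conjugate_def m_assoc)
  then have "conjugate G (inv v) (x [^] k) = s [^] k \<otimes> x [^] k"
    using int_pow_mult_distrib [of s x k] xs x v s by (simp add: conjugate_int_pow conjugate_fixed_iff)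
  then have "x [^] k \<otimes> v = v \<otimes> (s [^] k \<otimes> x [^] k)"
    using x v s by (metis conjugate_def int_pow_closed inv_closed inv_inv inv_solve_left' m_assoc m_closed)
  then show ?thesis using x v s by (simp add: conjugate_def inv_solve_right' m_assoc)
qed

end

section \<open>Bases of free groups\<close>

lemma eval_word_Nil [simp]: "eval_word G g [] = \<one>\<^bsub>G\<^esub>"
  by (simp add: eval_word_def)

lemma eval_word_Cons [simp]:
  "eval_word G g ((x, s) # w) = (if s then g x else inv\<^bsub>G\<^esub> (g x)) \<otimes>\<^bsub>G\<^esub> eval_word G g w"
  by (simp add: eval_word_def)

lemma (in group) eval_word_closed [simp]:
  "range g \<subseteq> carrier G \<Longrightarrow> eval_word G g w \<in> carrier G"
  by (induction w) (auto simp: image_subset_iff)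

lemma (in group) eval_word_append:
  assumes g: "range g \<subseteq> carrier G"
  shows "eval_word G g (w @ w') = eval_word G g w \<otimes> eval_word G g w'"
proof (induction w)
  case (Cons a w)
  have "g (fst a) \<in> carrier G" using g by blast
  with Cons g show ?case by (cases a) (simp add: m_assoc)
qed (simp add: g)

lemma (in group) eval_word_respects_equiv:
  assumes g: "range g \<subseteq> carrier G" and "word_equiv {} w w'"
  shows "eval_word G g w = eval_word G g w'"
  using assms(2)
proof induction
  case (cancel w x s w')
  have "g x \<in> carrier G" using g by blast
  then show ?case using g by (simp add: eval_word_append)
qed auto

lemma (in group_hom) hom_eval_word:
  assumes g: "range g \<subseteq> carrier G"
  shows "h (eval_word G g w) = eval_word H (\<lambda>x. h (g x)) w"
proof (induction w)
  case (Cons a w)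
  have "g (fst a) \<in> carrier G" using g by blast
  with Cons g show ?case by (cases a) simp
qed simp

lemma presented_by_relation:
  assumes "presented_by G g R" "(l, r) \<in> R"
  shows "eval_word G g l = eval_word G g r"
  using word_equiv.relation [OF assms(2), of "[]" "[]"] assms(1) by (simp add: presented_by_def)

lemma free_onD:
  assumes "free_on G g"
  shows "group G" "range g \<subseteq> carrier G" "carrier G = range (eval_word G g)"
    "eval_word G g w = eval_word G g w' \<longleftrightarrow> word_equiv {} w w'"
proof -
  note * = assms [unfolded free_on_def presented_by_def]
  show "group G" "range g \<subseteq> carrier G" "carrier G = range (eval_word G g)"
    by (rule * [THEN conjunct1] * [THEN conjunct2, THEN conjunct1]
        * [THEN conjunct2, THEN conjunct2, THEN conjunct1])+
  show "eval_word G g w = eval_word G g w' \<longleftrightarrow> word_equiv {} w w'"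
    by (rule * [THEN conjunct2, THEN conjunct2, THEN conjunct2, THEN spec, THEN spec])
qed

text \<open>
  The universal property: equal values of two words in a basis force the words to be freely
  equivalent, so evaluating the same words at other elements is well defined.
\<close>

lemma free_on_extend_hom:
  assumes free: "free_on G g" and H: "group H" and k: "range k \<subseteq> carrier H"
  shows "\<exists>f\<in>hom G H. \<forall>x. f (g x) = k x"
proof -
  interpret G: group G by (rule free_onD [OF free])
  interpret H: group H by (rule H)
  have g: "range g \<subseteq> carrier G" and gen: "carrier G = range (eval_word G g)"
    and eq: "\<And>w w'. eval_word G g w = eval_word G g w' \<longleftrightarrow> word_equiv {} w w'"
    by (rule free_onD [OF free])+
  let ?f = "\<lambda>z. eval_word H k (SOME w. eval_word G g w = z)"
  have f: "?f (eval_word G g w) = eval_word H k w" for w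
    by (rule H.eval_word_respects_equiv [OF k])
      (use someI [of "\<lambda>w'. eval_word G g w' = eval_word G g w" w] in \<open>simp add: eq\<close>)
  have "?f \<in> hom G H"
  proof (rule homI)
    fix x y assume "x \<in> carrier G" "y \<in> carrier G"
    then obtain w w' where xy: "x = eval_word G g w" "y = eval_word G g w'" by (auto simp: gen)
    then have "x \<otimes>\<^bsub>G\<^esub> y = eval_word G g (w @ w')" by (simp add: G.eval_word_append [OF g])
    then show "?f (x \<otimes>\<^bsub>G\<^esub> y) = ?f x \<otimes>\<^bsub>H\<^esub> ?f y"
      by (simp only: f xy H.eval_word_append [OF k])
  qed (simp add: k)
  moreover have "?f (g x) = k x" for x
  proof -
    have "g x \<in> carrier G" "k x \<in> carrier H" using g k by (auto simp: image_subset_iff)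
    then show ?thesis using f [of "gen x"] by simp
  qed
  ultimately show ?thesis by (intro bexI allI)
qed

text \<open>
  Freeness of the new family comes from \<open>\<alpha>\<close>, which sends a coincidence between words in it to
  one between words in the old basis; generation comes from \<open>\<beta>\<close>, which is onto as
  \<open>\<beta> \<circ> \<alpha>\<close> fixes the old basis.
\<close>

lemma free_on_change_basis:
  assumes free: "free_on G g"
    and \<alpha>: "\<alpha> \<in> hom G G" "\<And>x. \<alpha> (h x) = g x"
    and \<beta>: "\<beta> \<in> hom G G" "\<And>x. \<beta> (g x) = h x"
    and \<beta>\<alpha>: "\<And>x. \<beta> (\<alpha> (g x)) = g x"
  shows "free_on G h"
proof -
  interpret G: group G by (rule free_onD [OF free])
  interpret \<alpha>: group_hom G G \<alpha> by unfold_locales (rule \<alpha>)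
  interpret \<beta>: group_hom G G \<beta> by unfold_locales (rule \<beta>)
  have g: "range g \<subseteq> carrier G" and gen: "carrier G = range (eval_word G g)"
    and eq: "\<And>w w'. eval_word G g w = eval_word G g w' \<longleftrightarrow> word_equiv {} w w'"
    by (rule free_onD [OF free])+
  have h: "range h \<subseteq> carrier G"
    using g by (auto simp flip: \<beta>(2))
  have ag: "range (\<lambda>x. \<alpha> (g x)) \<subseteq> carrier G" using g by auto
  have \<alpha>_eval: "\<alpha> (eval_word G h w) = eval_word G g w" for w
    by (simp add: \<alpha>.hom_eval_word [OF h] \<alpha>(2))
  have \<beta>_eval: "\<beta> (eval_word G g w) = eval_word G h w" for w
    by (simp add: \<beta>.hom_eval_word [OF g] \<beta>(2))
  have "z \<in> range (eval_word G h)" if "z \<in> carrier G" for z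
  proof -
    obtain w where w: "z = eval_word G g w" using \<open>z \<in> carrier G\<close> gen by blast
    have "\<beta> (\<alpha> z) = z"
      by (simp add: w \<alpha>.hom_eval_word [OF g] \<beta>.hom_eval_word [OF ag] \<beta>\<alpha>)
    moreover obtain w' where "\<alpha> z = eval_word G g w'"
      using \<alpha>.hom_closed [OF \<open>z \<in> carrier G\<close>] gen by blast
    ultimately show ?thesis using \<beta>_eval [of w'] by auto
  qed
  then have "carrier G = range (eval_word G h)" using h by auto
  moreover have "eval_word G h w = eval_word G h w' \<longleftrightarrow> word_equiv {} w w'" for w w'
    using \<alpha>_eval G.eval_word_respects_equiv [OF h] by (metis eq)
  ultimately show ?thesis using h by (simp add: free_on_def presented_by_def G.is_group)
qed

text \<open>
  The endomorphism $x \mapsto x y$, $y \mapsto y^{-1}$ is an involution, hence an automorphism.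
\<close>

lemma free_on_product_basis:
  assumes free: "free_on G (\<lambda>i::bool. if i then x else y)"
  shows "free_on G (\<lambda>i::bool. if i then x \<otimes>\<^bsub>G\<^esub> y else inv\<^bsub>G\<^esub> y)"
proof -
  interpret G: group G by (rule free_onD [OF free])
  have xy [simp]: "x \<in> carrier G" "y \<in> carrier G"
    using free_onD(2) [OF free] by (auto simp: image_subset_iff split: if_splits)
  have ext: "\<exists>f. f \<in> hom G G \<and> f x = x' \<and> f y = y'"
    if "x' \<in> carrier G" "y' \<in> carrier G" for x' y'
  proof -
    have "range (\<lambda>i. if i then x' else y') \<subseteq> carrier G" using that by auto
    from free_on_extend_hom [OF free G.is_group this]
    obtain f where f: "f \<in> hom G G" "\<forall>i. f (if i then x else y) = (if i then x' else y')"
      by (rule bexE)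
    from f(2) [THEN spec, of True] f(2) [THEN spec, of False] f(1) show ?thesis by auto
  qed
  obtain f where f: "f \<in> hom G G" "f x = x \<otimes>\<^bsub>G\<^esub> y" "f y = inv\<^bsub>G\<^esub> y"
    using ext [of "x \<otimes>\<^bsub>G\<^esub> y" "inv\<^bsub>G\<^esub> y"] by auto
  interpret f: group_hom G G f by unfold_locales (rule f)
  show ?thesis
    by (rule free_on_change_basis [OF free f(1) _ f(1)]) (simp_all add: f(2,3) G.m_assoc)
qed

section \<open>Split extensions\<close>

locale split_extension = p: group_hom G H p + s: group_hom H G s
  for G (structure) and H (structure) and p s +
  assumes section_right_inverse: "\<And>h. h \<in> carrier H \<Longrightarrow> p (s h) = h"
begin

definition kernel_group where
  "kernel_group = G\<lparr>carrier := kernel G H p\<rparr>"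

text \<open>
  The restriction to the kernel makes the action extensional, as membership in
  \<^const>\<open>AutoGroup\<close> requires.
\<close>

definition section_action where
  "section_action h = (\<lambda>w\<in>carrier kernel_group. s h \<otimes> w \<otimes> inv (s h))"

lemma group_kernel_group: "group kernel_group"
  unfolding kernel_group_def by (rule p.G.subgroup_imp_group [OF p.subgroup_kernel])

lemma carrier_kernel_group: "carrier kernel_group = {w \<in> carrier G. p w = \<one>\<^bsub>H\<^esub>}"
  by (simp add: kernel_group_def kernel_def)

lemma mult_kernel_group [simp]: "mult kernel_group = mult G"
  by (simp add: kernel_group_def)

lemma conjugate_in_kernel:
  "h \<in> carrier H \<Longrightarrow> w \<in> carrier kernel_group \<Longrightarrow> s h \<otimes> w \<otimes> inv (s h) \<in> carrier kernel_group"
  by (simp add: carrier_kernel_group)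

lemma section_action_mult:
  assumes "h \<in> carrier H" "k \<in> carrier H"
  shows "section_action (h \<otimes>\<^bsub>H\<^esub> k) =
    compose (carrier kernel_group) (section_action h) (section_action k)"
  using assms conjugate_in_kernel [of k]
  by (auto simp: section_action_def compose_def fun_eq_iff carrier_kernel_group
      p.G.inv_mult_group p.G.m_assoc)

lemma section_action_one: "section_action \<one>\<^bsub>H\<^esub> = (\<lambda>w\<in>carrier kernel_group. w)"
  by (auto simp: section_action_def carrier_kernel_group fun_eq_iff)

lemma section_action_Bij:
  assumes h: "h \<in> carrier H"
  shows "section_action h \<in> Bij (carrier kernel_group)"
proof -
  have maps: "section_action k ` carrier kernel_group \<subseteq> carrier kernel_group" if "k \<in> carrier H" for k
    using conjugate_in_kernel [OF that] by (auto simp: section_action_def)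
  have inverse: "section_action k (section_action l w) = w"
    if "k \<in> carrier H" "l \<in> carrier H" "k \<otimes>\<^bsub>H\<^esub> l = \<one>\<^bsub>H\<^esub>" "w \<in> carrier kernel_group" for k l w
    using fun_cong [OF section_action_mult [of k l], of w] that
    by (simp add: section_action_one compose_def)
  have "bij_betw (section_action h) (carrier kernel_group) (carrier kernel_group)"
    using h by (intro bij_betw_byWitness [where f' = "section_action (inv\<^bsub>H\<^esub> h)"] ballI inverse maps)
      simp_all
  then show ?thesis by (simp add: Bij_def section_action_def)
qed

lemma section_action_auto:
  assumes h: "h \<in> carrier H"
  shows "section_action h \<in> auto kernel_group"
proof -
  interpret N: group kernel_group by (rule group_kernel_group)
  have "section_action h (x \<otimes> y) = section_action h x \<otimes> section_action h y"
    if "x \<in> carrier kernel_group" "y \<in> carrier kernel_group" for x y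
    using N.m_closed [OF that] that h
    by (simp add: section_action_def carrier_kernel_group p.G.m_assoc)
  then have "section_action h \<in> hom kernel_group kernel_group"
    using h conjugate_in_kernel by (intro homI) (simp_all add: section_action_def)
  then show ?thesis using section_action_Bij [OF h] by (simp add: auto_def)
qed

lemma section_action_hom: "section_action \<in> hom H (AutoGroup kernel_group)"
  by (rule homI) (simp_all add: AutoGroup_def BijGroup_def section_action_auto section_action_mult
      section_action_Bij)

text \<open>
  Every \<open>g\<close> splits uniquely as an element of the kernel times \<open>s (p g)\<close>, and moving a section value
  past an element of the kernel costs a conjugation, which is the twist in the semidirect product.
\<close>

lemma semidirect_isomorphisms:
  "group_isomorphisms (sdprod kernel_group H section_action) G
     (\<lambda>(w, h). w \<otimes> s h) (\<lambda>g. (g \<otimes> inv (s (p g)), p g))"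
  unfolding group_isomorphisms_def
proof (intro conjI ballI)
  let ?S = "sdprod kernel_group H section_action"
  show "(\<lambda>(w, h). w \<otimes> s h) \<in> hom ?S G"
    by (rule homI) (auto simp: sdprod_def carrier_kernel_group section_action_def p.G.m_assoc)
  show "(\<lambda>g. (g \<otimes> inv (s (p g)), p g)) \<in> hom G ?S"
    by (rule homI) (auto simp: sdprod_def carrier_kernel_group section_action_def p.G.m_assoc
        p.G.inv_mult_group section_right_inverse)
qed (auto simp: sdprod_def carrier_kernel_group section_right_inverse p.G.m_assoc)

end

section \<open>The group of the Klein bottle\<close>

lemma group_int_sdprod: "group int_sdprod"
proof (rule groupI)
  fix x assume "x \<in> carrier int_sdprod"
  show "\<exists>y\<in>carrier int_sdprod. y \<otimes>\<^bsub>int_sdprod\<^esub> x = \<one>\<^bsub>int_sdprod\<^esub>"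
    by (rule bexI [of _ "(- alt_sign (snd x) * fst x, - snd x)"])
      (auto simp: int_sdprod_def alt_sign_eq split: prod.splits)
qed (auto simp: int_sdprod_def alt_sign_eq algebra_simps)

lemma carrier_int_sdprod [simp]: "carrier int_sdprod = UNIV"
  by (simp add: int_sdprod_def)

lemma mult_int_sdprod [simp]:
  "(r1, s1) \<otimes>\<^bsub>int_sdprod\<^esub> (r2, s2) = (r1 + alt_sign s1 * r2, s1 + s2)"
  by (simp add: int_sdprod_def)

lemma one_int_sdprod [simp]: "\<one>\<^bsub>int_sdprod\<^esub> = (0, 0)"
  by (simp add: int_sdprod_def)

lemma inv_int_sdprod [simp]: "inv\<^bsub>int_sdprod\<^esub> (r, s) = (- alt_sign s * r, - s)"
  by (rule group.inv_equality [OF group_int_sdprod]) (auto simp: alt_sign_eq)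

text \<open>
  The two coordinate axes are images of the integers under homomorphisms, so their elements are
  powers of the two generators. Homomorphisms are therefore known once their values there are.
\<close>

lemma int_sdprod_generators:
  "(m, n) = (1, 0) [^]\<^bsub>int_sdprod\<^esub> m \<otimes>\<^bsub>int_sdprod\<^esub> (0, 1) [^]\<^bsub>int_sdprod\<^esub> n"
proof -
  have hom: "(\<lambda>k. (k, 0)) \<in> hom integer_group int_sdprod" "(\<lambda>k. (0, k)) \<in> hom integer_group int_sdprod"
    by (auto simp: hom_def int_sdprod_def alt_sign_eq)
  have "(1, 0) [^]\<^bsub>int_sdprod\<^esub> m = (m, 0)"
    using hom_int_pow [OF hom(1) _ group_integer_group group_int_sdprod, of 1 m] by simp
  moreover have "(0, 1) [^]\<^bsub>int_sdprod\<^esub> n = (0, n)"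
    using hom_int_pow [OF hom(2) _ group_integer_group group_int_sdprod, of 1 n] by simp
  ultimately show ?thesis by simp
qed

lemma hom_int_sdprod_eq:
  assumes "group G" "f \<in> hom int_sdprod G"
  shows "f (m, n) = f (1, 0) [^]\<^bsub>G\<^esub> m \<otimes>\<^bsub>G\<^esub> f (0, 1) [^]\<^bsub>G\<^esub> n"
proof -
  interpret group_hom int_sdprod G f
    using assms group_int_sdprod by (simp add: group_hom_def group_hom_axioms_def)
  have "f (m, n) = f ((1, 0) [^]\<^bsub>int_sdprod\<^esub> m \<otimes>\<^bsub>int_sdprod\<^esub> (0, 1) [^]\<^bsub>int_sdprod\<^esub> n)"
    by (simp flip: int_sdprod_generators)
  also have "\<dots> = f (1, 0) [^]\<^bsub>G\<^esub> m \<otimes>\<^bsub>G\<^esub> f (0, 1) [^]\<^bsub>G\<^esub> n"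
    by (simp add: hom_int_pow)
  finally show ?thesis .
qed

section \<open>Conjugation in the braid group\<close>

context group
begin

text \<open>
  The commutator relation is equivalent to $b a b^{-1} = a B^{-1}$. Substituted into
  $b a = B (a B^{-1} b) B$ it gives $b a = B (b a) B$, so that $b a$ conjugates $B$ to its inverse.
  The action of $a$ itself is then obtained by removing the factor $b$.
\<close>

lemma handle_relations:
  assumes a: "a \<in> carrier G" and b: "b \<in> carrier G" and B: "B \<in> carrier G"
    and r1: "b \<otimes> a = B \<otimes> a \<otimes> inv B \<otimes> b \<otimes> B"
    and r2: "a \<otimes> b \<otimes> inv a \<otimes> inv b = a \<otimes> B \<otimes> inv a"
  shows "conjugate G (b \<otimes> a) B = inv B"
    and "conjugate G a B = inv b \<otimes> inv B \<otimes> b"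
    and "conjugate G a b = inv b \<otimes> inv B \<otimes> b \<otimes> b"
proof -
  have "conjugate G a b = conjugate G a B \<otimes> b"
    using r2 a b B by (simp add: conjugate_def inv_solve_right')
  have "b \<otimes> inv a \<otimes> inv b = B \<otimes> inv a"
    using r2 a b B by (simp add: m_assoc)
  then have "inv (b \<otimes> inv a \<otimes> inv b) = inv (B \<otimes> inv a)" by simp
  then have "b \<otimes> a \<otimes> inv b = a \<otimes> inv B"
    using a b B by (simp add: inv_mult_group m_assoc)
  then have ab: "a \<otimes> inv B \<otimes> b = b \<otimes> a"
    using a b B inv_solve_right' [of "a \<otimes> inv B" "b \<otimes> a" b] by simp
  have "b \<otimes> a = B \<otimes> ((a \<otimes> inv B \<otimes> b) \<otimes> B)" using r1 a b B by (simp add: m_assoc)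
  then have "b \<otimes> a = B \<otimes> ((b \<otimes> a) \<otimes> B)" by (simp only: ab)
  then have "inv B \<otimes> (b \<otimes> a) = (b \<otimes> a) \<otimes> B"
    using a b B inv_solve_left' [of "b \<otimes> a \<otimes> B" B "b \<otimes> a"] by simp
  then show c: "conjugate G (b \<otimes> a) B = inv B"
    using a b B by (simp add: conjugate_def inv_solve_right')
  have "conjugate G a B = conjugate G (inv b \<otimes> (b \<otimes> a)) B" using a b by simp
  also have "\<dots> = conjugate G (inv b) (inv B)"
    using a b B c by (simp add: conjugate_mult_left del: inv_mult_cancel)
  finally show "conjugate G a B = inv b \<otimes> inv B \<otimes> b" using b by (simp add: conjugate_def)
  with \<open>conjugate G a b = conjugate G a B \<otimes> b\<close>
  show "conjugate G a b = inv b \<otimes> inv B \<otimes> b \<otimes> b" by simp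
qed

text \<open>
  Conjugation by $a_r$ is known on $b_r$ and $B$ by the previous lemma, and $a_1$ commutes with
  $b_2$. The only value missing is that of $a_2$ on $b_1$; the relation between $b_1$ and
  $B a_2 B^{-1}$ supplies it, since it says that $a_2$ commutes with $B^{-1} b_1 B$. What remains
  is evaluating words in $b_1$, $b_2$ after replacing $B$ by $b_1^2 b_2^2$.
\<close>

lemma klein_braid_conjugation:
  assumes gens: "a1 \<in> carrier G" "a2 \<in> carrier G" "b1 \<in> carrier G" "b2 \<in> carrier G" "B \<in> carrier G"
    and h1: "b1 \<otimes> a1 = B \<otimes> a1 \<otimes> inv B \<otimes> b1 \<otimes> B" "a1 \<otimes> b1 \<otimes> inv a1 \<otimes> inv b1 = a1 \<otimes> B \<otimes> inv a1"
    and h2: "b2 \<otimes> a2 = B \<otimes> a2 \<otimes> inv B \<otimes> b2 \<otimes> B" "a2 \<otimes> b2 \<otimes> inv a2 \<otimes> inv b2 = a2 \<otimes> B \<otimes> inv a2"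
    and b1a2: "b1 \<otimes> B \<otimes> a2 \<otimes> inv B = B \<otimes> a2 \<otimes> inv B \<otimes> b1"
    and a1b2: "a1 \<otimes> b2 \<otimes> inv a1 \<otimes> inv b2 = \<one>"
    and B_eq: "B = b1 \<otimes> b1 \<otimes> b2 \<otimes> b2"
    and u: "u = b1 \<otimes> b2" and v: "v = inv b2"
  shows "conjugate G (b1 \<otimes> a1) u = inv u"
    and "conjugate G (b1 \<otimes> a1) v = B \<otimes> v \<otimes> inv u \<otimes> inv u"
    and "conjugate G (b2 \<otimes> a2) u = inv B \<otimes> inv u \<otimes> B"
    and "conjugate G (b2 \<otimes> a2) v = v \<otimes> B"
proof -
  note a1 = handle_relations [OF gens(1,3,5) h1] and a2 = handle_relations [OF gens(2,4,5) h2]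
  have "conjugate G a1 b2 = b2"
    using a1b2 gens by (simp add: conjugate_def inv_solve_right')
  with a1 show "conjugate G (b1 \<otimes> a1) u = inv u" "conjugate G (b1 \<otimes> a1) v = B \<otimes> v \<otimes> inv u \<otimes> inv u"
    using gens by (simp_all add: u v conjugate_mult_left conjugate_mult conjugate_inv)
      (simp_all add: conjugate_def B_eq inv_mult_group m_assoc)
  \<comment> \<open>The relation between \<open>b1\<close> and \<open>B a2 B\<^sup>-\<^sup>1\<close>, conjugated by \<open>B\<^sup>-\<^sup>1\<close>.\<close>
  have "conjugate G a2 (inv B \<otimes> b1 \<otimes> B) = inv B \<otimes> b1 \<otimes> B"
  proof -
    have "inv B \<otimes> (B \<otimes> a2 \<otimes> inv B \<otimes> b1) \<otimes> B = inv B \<otimes> (b1 \<otimes> B \<otimes> a2 \<otimes> inv B) \<otimes> B"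
      by (simp only: b1a2)
    then have "a2 \<otimes> (inv B \<otimes> b1 \<otimes> B) = (inv B \<otimes> b1 \<otimes> B) \<otimes> a2"
      using gens by (simp add: m_assoc)
    then show ?thesis using gens by (simp add: conjugate_fixed_iff)
  qed
  moreover have "b1 = B \<otimes> (inv B \<otimes> b1 \<otimes> B) \<otimes> inv B" using gens by (simp add: m_assoc)
  then have "conjugate G a2 b1 =
      conjugate G a2 B \<otimes> conjugate G a2 (inv B \<otimes> b1 \<otimes> B) \<otimes> inv (conjugate G a2 B)"
    using gens by (metis conjugate_inv conjugate_mult inv_closed m_closed)
  ultimately have "conjugate G a2 b1 =
      inv b2 \<otimes> inv B \<otimes> b2 \<otimes> (inv B \<otimes> b1 \<otimes> B) \<otimes> inv (inv b2 \<otimes> inv B \<otimes> b2)"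
    by (simp only: a2(2))
  with a2 show "conjugate G (b2 \<otimes> a2) u = inv B \<otimes> inv u \<otimes> B" "conjugate G (b2 \<otimes> a2) v = v \<otimes> B"
    using gens by (simp_all add: u v conjugate_mult_left conjugate_mult conjugate_inv)
      (simp_all add: conjugate_def B_eq inv_mult_group m_assoc)
qed

lemma conjugate_involution_int_pow:
  assumes "y \<in> carrier G" "w \<in> carrier G" "conjugate G y (conjugate G y w) = w"
  shows "conjugate G (y [^] (n :: int)) w = (if even n then w else conjugate G y w)"
proof -
  have even: "conjugate G (y [^] (2 * k)) w = w" for k :: int
  proof -
    have "y [^] (2 * k) = (y \<otimes> y) [^] k"
      using assms int_pow_pow [of y 2 k] int_pow_mult [of y 1 1] by simp
    moreover have "conjugate G (y \<otimes> y) w = w" using assms by (simp add: conjugate_mult_left)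
    ultimately show ?thesis using assms conjugate_fixed_int_pow [of "y \<otimes> y" w k] by simp
  qed
  show ?thesis
  proof (cases "even n")
    case True
    then show ?thesis using even by auto
  next
    case False
    then obtain k where "n = 1 + 2 * k" by (metis add.commute oddE)
    then have "y [^] n = y \<otimes> y [^] (2 * k)"
      using assms int_pow_mult [of y 1 "2 * k"] by simp
    then show ?thesis using False assms even [of k] by (simp add: conjugate_mult_left)
  qed
qed

text \<open>
  Here \<open>g\<close> is the value of the section at $(m, n)$, written as $(c_1 c_2)^m (c_2^{-1})^n$. The
  asymmetric exponents in the result come from the case of odd $n$, where conjugation by $c_2$
  contributes an extra $B^{-1} \cdot B$ around $u$ and an extra $B$ after $v$, which
  $(c_1 c_2)^m$ fixes.
\<close>

lemma conjugate_klein_section: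
  assumes car: "c1 \<in> carrier G" "c2 \<in> carrier G" "u \<in> carrier G" "v \<in> carrier G" "B \<in> carrier G"
    and c1: "conjugate G c1 u = inv u" "conjugate G c1 v = B \<otimes> v \<otimes> inv u \<otimes> inv u" "conjugate G c1 B = inv B"
    and c2: "conjugate G c2 u = inv B \<otimes> inv u \<otimes> B" "conjugate G c2 v = v \<otimes> B" "conjugate G c2 B = inv B"
    and g: "g = (c1 \<otimes> c2) [^] m \<otimes> (inv c2) [^] n"
  shows "conjugate G g u = B [^] (m - odd_delta n) \<otimes> u [^] alt_sign n \<otimes> B [^] (- m + odd_delta n)"
    and "conjugate G g v = B [^] m \<otimes> v \<otimes> u [^] (- 2 * m) \<otimes> B [^] (- m + odd_delta n)"
    and "conjugate G g B = B [^] alt_sign n"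
proof -
  let ?x = "c1 \<otimes> c2" and ?y = "inv c2" and ?z = "inv B \<otimes> (c1 \<otimes> c2)"
  note conj = conjugate_mult_left conjugate_mult conjugate_inv
  have x: "conjugate G ?x u = B \<otimes> u \<otimes> inv B" "conjugate G ?x B = B"
      "conjugate G ?x v = B \<otimes> v \<otimes> inv u \<otimes> inv u \<otimes> inv B"
    using car by (simp_all add: conj c1 c2 inv_mult_group m_assoc)
  have u2: "u [^] (- 2 :: int) = inv u \<otimes> inv u"
    using car int_pow_mult [of u "- 1" "- 1"] by (simp add: int_pow_neg)
  have z: "conjugate G ?z u = u" "conjugate G ?z v = v \<otimes> u [^] (- 2 :: int)"
    using car x by (simp_all add: conjugate_mult_left [of "inv B"] u2)
      (simp_all add: conjugate_def m_assoc)
  then have zu2: "conjugate G ?z (u [^] (- 2 :: int)) = u [^] (- 2 :: int)"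
    using car by (simp add: conjugate_int_pow)
  \<comment> \<open>As \<open>B\<close> and \<open>z\<close> commute, the power of \<open>x = B z\<close> splits.\<close>
  have "conjugate G B ?z = ?z"
  proof -
    have "?x \<otimes> B = B \<otimes> ?x" using x(2) car by (simp add: conjugate_fixed_iff)
    then have "B \<otimes> ?z = ?z \<otimes> B" using car by (simp add: m_assoc)
    then show ?thesis using car by (simp add: conjugate_fixed_iff)
  qed
  then have "(B \<otimes> ?z) [^] m = B [^] m \<otimes> ?z [^] m"
    using car by (intro int_pow_mult_distrib) (simp_all add: conjugate_fixed_iff)
  then have xm: "?x [^] m = B [^] m \<otimes> ?z [^] m" using car by simp
  have xB: "conjugate G (?x [^] m) B = B"
    using car x by (simp add: conjugate_fixed_int_pow)
  have xu: "conjugate G (?x [^] m) u = B [^] m \<otimes> u \<otimes> B [^] (- m)"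
    using car z by (simp add: xm conjugate_mult_left conjugate_fixed_int_pow)
      (simp add: conjugate_def int_pow_neg)
  have "conjugate G (?z [^] m) v = v \<otimes> u [^] (- 2 * m)"
    using car z zu2 conjugate_transvection_int_pow [of ?z v "u [^] (- 2 :: int)" m]
    by (simp add: int_pow_pow mult.commute)
  then have xv: "conjugate G (?x [^] m) v = B [^] m \<otimes> v \<otimes> u [^] (- 2 * m) \<otimes> B [^] (- m)"
    using car by (simp add: xm conjugate_mult_left)
      (simp add: conjugate_def int_pow_neg m_assoc)
  \<comment> \<open>An involution is its own inverse, so \<open>c2\<close> and its inverse act alike.\<close>
  have inv_y: "conjugate G ?y w = conjugate G c2 w"
    if "conjugate G c2 (conjugate G c2 w) = w" "w \<in> carrier G" for w
    using conjugate_inv_left [of c2 "conjugate G c2 w"] that car by simp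
  have c2c2: "conjugate G c2 (conjugate G c2 u) = u" "conjugate G c2 (conjugate G c2 v) = v"
      "conjugate G c2 (conjugate G c2 B) = B"
    using car by (simp_all add: conj c2 inv_mult_group m_assoc)
  have y: "conjugate G (?y [^] n) w = (if even n then w else conjugate G c2 w)"
    if "w \<in> carrier G" "conjugate G c2 (conjugate G c2 w) = w" for w
    using conjugate_involution_int_pow [of ?y w n] inv_y [of w] inv_y [of "conjugate G c2 w"] that car
    by simp
  have gw: "conjugate G g w = conjugate G (?x [^] m) (conjugate G (?y [^] n) w)" if "w \<in> carrier G" for w
    using car that by (simp add: g conjugate_mult_left)
  have Bpow: "inv B \<otimes> B [^] m = B [^] (m - 1)" "B [^] (- m) \<otimes> B = B [^] (- m + 1)"
    using car int_pow_mult [of B "-1" m] int_pow_mult [of B "-m" 1] by (simp_all add: int_pow_neg)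
  show "conjugate G g B = B [^] alt_sign n"
    using car c2c2 by (simp add: gw y c2 conjugate_inv xB alt_sign_eq int_pow_neg)
  show "conjugate G g v = B [^] m \<otimes> v \<otimes> u [^] (- 2 * m) \<otimes> B [^] (- m + odd_delta n)"
  proof (cases "even n")
    case True
    then show ?thesis using car c2c2 by (simp add: gw y xv odd_delta_def)
  next
    case False
    then have "conjugate G g v = B [^] m \<otimes> v \<otimes> u [^] (- 2 * m) \<otimes> B [^] (- m) \<otimes> B"
      using car c2c2 by (simp add: gw y c2 conjugate_mult xv xB)
    then show ?thesis using False car by (simp add: m_assoc Bpow odd_delta_def)
  qed
  show "conjugate G g u = B [^] (m - odd_delta n) \<otimes> u [^] alt_sign n \<otimes> B [^] (- m + odd_delta n)"
  proof (cases "even n")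
    case True
    then show ?thesis using car c2c2 by (simp add: gw y xu odd_delta_def alt_sign_eq)
  next
    case False
    then have "conjugate G g u = inv B \<otimes> inv (B [^] m \<otimes> u \<otimes> B [^] (- m)) \<otimes> B"
      using car c2c2 by (simp add: gw y c2 conjugate_mult conjugate_inv xu xB)
    also have "\<dots> = (inv B \<otimes> B [^] m) \<otimes> inv u \<otimes> (B [^] (- m) \<otimes> B)"
      using car by (simp add: int_pow_neg inv_mult_group m_assoc)
    also have "\<dots> = B [^] (m - 1) \<otimes> u [^] (- 1 :: int) \<otimes> B [^] (- m + 1)"
      using car int_pow_neg [of u 1] by (simp only: Bpow) simp
    finally show ?thesis using False by (simp add: odd_delta_def alt_sign_eq)
  qed
qed

end

section \<open>The pure braid group as a semidirect product\<close>

theorem theorem23: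
  fixes P :: "(real \<Rightarrow> klein_bottle \<times> klein_bottle) set monoid" (structure)
    and y1 y2 :: klein_bottle
    and a1 a2 b1 b2 B u v :: "(real \<Rightarrow> klein_bottle \<times> klein_bottle) set"
    and \<iota> :: "(real \<Rightarrow> klein_bottle) set \<Rightarrow> int \<times> int"
    and p :: "(real \<Rightarrow> klein_bottle \<times> klein_bottle) set \<Rightarrow> int \<times> int"
    and F :: "(real \<Rightarrow> klein_bottle \<times> klein_bottle) set monoid"
    and \<phi> :: "int \<times> int \<Rightarrow> (real \<Rightarrow> klein_bottle \<times> klein_bottle) set"
    and \<theta> :: "int \<times> int \<Rightarrow> (real \<Rightarrow> klein_bottle \<times> klein_bottle) set \<Rightarrow> (real \<Rightarrow> klein_bottle \<times> klein_bottle) set"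
    and lam :: "(real \<Rightarrow> klein_bottle \<times> klein_bottle) set \<times> (int \<times> int) \<Rightarrow> (real \<Rightarrow> klein_bottle \<times> klein_bottle) set"
    and \<gamma> :: "(real \<Rightarrow> klein_bottle \<times> klein_bottle) set \<Rightarrow> (real \<Rightarrow> klein_bottle \<times> klein_bottle) set \<times> (int \<times> int)"
  assumes basepoint: "y1 \<noteq> y2"
    and P: "P = fundamental_group ordered_config2 (y1, y2)"
    and presentation:
      "presented_by P
         (\<lambda>x. case x of Ga1 \<Rightarrow> a1 | Ga2 \<Rightarrow> a2 | Gb1 \<Rightarrow> b1 | Gb2 \<Rightarrow> b2 | GB \<Rightarrow> B)
         klein_braid_relations"
    and identification: "\<iota> \<in> iso (fundamental_group UNIV y1) int_sdprod"
    and p: "\<And>g. p g = \<iota> (induced_map UNIV fst g)"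
    and p_gens: "p a1 = (1, 1)" "p a2 = (0, -1)" "p b1 = (0, 0)" "p b2 = (0, 0)"
    and F: "F = P\<lparr>carrier := kernel P int_sdprod p\<rparr>"
    and F_free: "free_on F (\<lambda>i::bool. if i then b1 else b2)"
    and u: "u = b1 \<otimes> b2"
    and v: "v = inv b2"
    and \<phi>_hom: "\<phi> \<in> hom int_sdprod P"
    and \<phi>_gens: "\<phi> (1, 0) = b1 \<otimes> a1 \<otimes> b2 \<otimes> a2" "\<phi> (0, 1) = inv a2 \<otimes> inv b2"
    and \<theta>: "\<And>g. \<theta> g = (\<lambda>w\<in>carrier F. \<phi> g \<otimes> w \<otimes> inv (\<phi> g))"
    and lam: "\<And>w g. lam (w, g) = w \<otimes> \<phi> g"
    and \<gamma>: "\<And>g. \<gamma> g = (g \<otimes> inv (\<phi> (p g)), p g)"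
  shows "free_on F (\<lambda>i::bool. if i then u else v) \<and>
    B = u \<otimes> v \<otimes> u \<otimes> inv v \<and>
    \<theta> \<in> hom int_sdprod (AutoGroup F) \<and>
    (\<forall>m n.
       \<theta> (m, n) u = B [^] (m - odd_delta n) \<otimes> u [^] alt_sign n \<otimes> B [^] (- m + odd_delta n) \<and>
       \<theta> (m, n) v = B [^] m \<otimes> v \<otimes> u [^] (- 2 * m) \<otimes> B [^] (- m + odd_delta n) \<and>
       \<theta> (m, n) B = B [^] alt_sign n) \<and>
    lam \<in> iso (sdprod F int_sdprod \<theta>) P \<and>
    \<gamma> \<in> iso P (sdprod F int_sdprod \<theta>) \<and>
    (\<forall>x\<in>carrier (sdprod F int_sdprod \<theta>). \<gamma> (lam x) = x) \<and>
    (\<forall>g\<in>carrier P. lam (\<gamma> g) = g) \<and>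
    lam (u, (0, 0)) = b1 \<otimes> b2 \<and>
    lam (v, (0, 0)) = inv b2 \<and>
    lam (B, (0, 0)) = B \<and>
    lam (\<one>, (1, 0)) = b1 \<otimes> a1 \<otimes> b2 \<otimes> a2 \<and>
    lam (\<one>, (0, 1)) = inv a2 \<otimes> inv b2 \<and>
    \<gamma> a1 = (inv v \<otimes> inv u, (1, 1)) \<and>
    \<gamma> a2 = (v, (0, -1)) \<and>
    \<gamma> b1 = (u \<otimes> v, (0, 0)) \<and>
    \<gamma> b2 = (inv v, (0, 0)) \<and>
    \<gamma> B = (B, (0, 0)) \<and>
    (\<forall>w\<in>carrier F. \<forall>m n. p (lam (w, (m, n))) = (m, n))"
proof -
  let ?g = "\<lambda>x. case x of Ga1 \<Rightarrow> a1 | Ga2 \<Rightarrow> a2 | Gb1 \<Rightarrow> b1 | Gb2 \<Rightarrow> b2 | GB \<Rightarrow> B"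
  interpret P: group P using presentation unfolding presented_by_def by (rule conjunct1)
  have gens: "a1 \<in> carrier P" "a2 \<in> carrier P" "b1 \<in> carrier P" "b2 \<in> carrier P" "B \<in> carrier P"
  proof -
    have "range ?g \<subseteq> carrier P"
      using presentation unfolding presented_by_def by (elim conjE)
    then have "?g x \<in> carrier P" for x by (rule range_subsetD)
    from this [of Ga1] this [of Ga2] this [of Gb1] this [of Gb2] this [of GB]
    show "a1 \<in> carrier P" "a2 \<in> carrier P" "b1 \<in> carrier P" "b2 \<in> carrier P" "B \<in> carrier P"
      by simp_all
  qed
  have uv: "u \<in> carrier P" "v \<in> carrier P" using gens by (simp_all add: u v)

  note rel = presented_by_relation [OF presentation]
  note rel_simps = klein_braid_relations_def Let_def word_comm_def word_inv_def gens P.m_assoc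
  have h1: "b1 \<otimes> a1 = B \<otimes> a1 \<otimes> inv B \<otimes> b1 \<otimes> B" "a1 \<otimes> b1 \<otimes> inv a1 \<otimes> inv b1 = a1 \<otimes> B \<otimes> inv a1"
    using rel [of "gen Gb1 @ gen Ga1" "gen GB @ gen Ga1 @ word_inv (gen GB) @ gen Gb1 @ gen GB"]
      rel [of "word_comm (gen Ga1) (gen Gb1)" "gen Ga1 @ gen GB @ word_inv (gen Ga1)"]
    by (simp_all add: rel_simps)
  have h2: "b2 \<otimes> a2 = B \<otimes> a2 \<otimes> inv B \<otimes> b2 \<otimes> B" "a2 \<otimes> b2 \<otimes> inv a2 \<otimes> inv b2 = a2 \<otimes> B \<otimes> inv a2"
    using rel [of "gen Gb2 @ gen Ga2" "gen GB @ gen Ga2 @ word_inv (gen GB) @ gen Gb2 @ gen GB"]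
      rel [of "word_comm (gen Ga2) (gen Gb2)" "gen Ga2 @ gen GB @ word_inv (gen Ga2)"]
    by (simp_all add: rel_simps)
  have b1a2: "b1 \<otimes> B \<otimes> a2 \<otimes> inv B = B \<otimes> a2 \<otimes> inv B \<otimes> b1"
    using rel [of "gen Gb1 @ gen GB @ gen Ga2 @ word_inv (gen GB)"
        "gen GB @ gen Ga2 @ word_inv (gen GB) @ gen Gb1"]
    by (simp add: rel_simps)
  have a1b2: "a1 \<otimes> b2 \<otimes> inv a1 \<otimes> inv b2 = \<one>"
    using rel [of "word_comm (gen Ga1) (gen Gb2)" "[]"] by (simp add: rel_simps)
  have B_eq: "B = b1 \<otimes> b1 \<otimes> b2 \<otimes> b2"
    using rel [of "gen Gb1 @ gen Gb1 @ gen Gb2 @ gen Gb2" "gen GB"] by (simp add: rel_simps)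

  \<comment> \<open>The only topological input: a continuous map induces a homomorphism.\<close>
  have induced: "induced_map UNIV fst \<in> hom P (fundamental_group UNIV y1)"
    using induced_map_hom [of ordered_config2 fst UNIV "(y1, y2)"]
    by (simp add: P continuous_on_fst continuous_on_id)
  have "p = \<iota> \<circ> induced_map UNIV fst" by (simp add: p fun_eq_iff)
  then have p_hom: "p \<in> hom P int_sdprod"
    using Group.hom_compose [OF induced] identification by (auto simp: iso_def)
  interpret p: group_hom P int_sdprod p
    using p_hom group_int_sdprod by (simp add: group_hom_def group_hom_axioms_def P.is_group)
  interpret \<phi>: group_hom int_sdprod P \<phi>
    using \<phi>_hom group_int_sdprod by (simp add: group_hom_def group_hom_axioms_def P.is_group)
  have \<phi>_eq: "\<phi> (m, n) = (b1 \<otimes> a1 \<otimes> (b2 \<otimes> a2)) [^] m \<otimes> (inv (b2 \<otimes> a2)) [^] n" for m n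
    using hom_int_sdprod_eq [OF P.is_group \<phi>_hom, of m n] gens
    by (simp add: \<phi>_gens P.inv_mult_group P.m_assoc)
  \<comment> \<open>Two homomorphisms that agree on both generators are equal.\<close>
  have p\<phi>: "p (\<phi> g) = g" for g
  proof -
    have "p (\<phi> (1, 0)) = (1, 0)" "p (\<phi> (0, 1)) = (0, 1)"
      using gens by (simp_all add: \<phi>_gens p_gens alt_sign_eq)
    moreover have "(\<lambda>g. p (\<phi> g)) \<in> hom int_sdprod int_sdprod"
      using Group.hom_compose [OF \<phi>_hom p_hom] by (simp add: comp_def)
    ultimately show ?thesis
      using hom_int_sdprod_eq [OF group_int_sdprod, of "\<lambda>g. p (\<phi> g)" "fst g" "snd g"]
      by (simp flip: int_sdprod_generators)
  qed
  interpret E: split_extension P int_sdprod p \<phi>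
    by unfold_locales (simp add: p\<phi>)

  have F_eq: "F = E.kernel_group" by (simp add: F E.kernel_group_def)
  have \<theta>_eq: "\<theta> = E.section_action" by (simp add: \<theta> F_eq E.section_action_def fun_eq_iff)
  have carF: "w \<in> carrier F \<longleftrightarrow> w \<in> carrier P \<and> p w = (0, 0)" for w
    by (simp add: F_eq E.carrier_kernel_group)
  have bF: "b1 \<in> carrier F" "b2 \<in> carrier F" using gens by (simp_all add: carF p_gens)
  interpret F: group F unfolding F_eq by (rule E.group_kernel_group)
  have mult_F: "x \<otimes>\<^bsub>F\<^esub> y = x \<otimes> y" for x y by (simp add: F)
  have inv_F: "inv\<^bsub>F\<^esub> x = inv x" if "x \<in> carrier F" for x
    using P.m_inv_consistent [OF p.subgroup_kernel] that by (simp add: F)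
  have uvF: "u \<in> carrier F" "v \<in> carrier F"
    using F.m_closed [OF bF] F.inv_closed [OF bF(2)] by (simp_all add: u v mult_F inv_F bF)
  have BF: "B \<in> carrier F"
    using F.m_closed [OF F.m_closed [OF F.m_closed [OF bF(1) bF(1)] bF(2)] bF(2)]
    by (simp add: B_eq mult_F)

  have basis: "free_on F (\<lambda>i::bool. if i then u else v)"
    using free_on_product_basis [OF F_free] by (simp add: u v mult_F inv_F bF cong: if_cong)

  \<comment> \<open>The conjugation formulas apply with \<open>c1 = b1 a1\<close> and \<open>c2 = b2 a2\<close>.\<close>
  note conj = P.conjugate_klein_section [OF _ _ uv gens(5)
      P.klein_braid_conjugation(1,2) [OF gens h1 h2 b1a2 a1b2 B_eq u v]
      P.handle_relations(1) [OF gens(1,3,5) h1]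
      P.klein_braid_conjugation(3,4) [OF gens h1 h2 b1a2 a1b2 B_eq u v]
      P.handle_relations(1) [OF gens(2,4,5) h2] \<phi>_eq]
  have \<theta>_conj: "\<theta> g w = conjugate P (\<phi> g) w" if "w \<in> carrier F" for g w
    using that by (simp add: \<theta> conjugate_def)

  have lam_eq: "lam = (\<lambda>(w, h). w \<otimes> \<phi> h)" by (simp add: lam fun_eq_iff)
  have \<gamma>_eq: "\<gamma> = (\<lambda>g. (g \<otimes> inv (\<phi> (p g)), p g))" by (simp add: \<gamma> fun_eq_iff)
  have isos: "group_isomorphisms (sdprod F int_sdprod \<theta>) P lam \<gamma>"
    using E.semidirect_isomorphisms by (simp only: F_eq \<theta>_eq lam_eq \<gamma>_eq)

  have \<phi>0: "\<phi> (0, 0) = \<one>" using \<phi>.hom_one by simp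
  have \<phi>a1: "\<phi> (1, 1) = b1 \<otimes> a1" and \<phi>a2: "\<phi> (0, -1) = b2 \<otimes> a2"
    using gens by (simp_all add: \<phi>_eq P.int_pow_neg P.m_assoc P.inv_mult_group)
  have pB: "p B = (0, 0)" using BF by (simp add: carF)
  have "B = u \<otimes> v \<otimes> u \<otimes> inv v" using gens by (simp add: B_eq u v P.m_assoc)
  moreover have "p (lam (w, g)) = g" if "w \<in> carrier F" for w g
    using that p\<phi> [of g] by (cases g) (simp add: lam carF alt_sign_eq)
  moreover have "\<gamma> a1 = (inv v \<otimes> inv u, (1, 1))" "\<gamma> a2 = (v, (0, -1))" "\<gamma> b1 = (u \<otimes> v, (0, 0))"
      "\<gamma> b2 = (inv v, (0, 0))" "\<gamma> B = (B, (0, 0))"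
    using gens by (simp_all add: \<gamma> p_gens pB \<phi>0 \<phi>a1 \<phi>a2 u v P.inv_mult_group P.m_assoc)
  moreover have "lam (u, (0, 0)) = b1 \<otimes> b2" "lam (v, (0, 0)) = inv b2" "lam (B, (0, 0)) = B"
      "lam (\<one>, (1, 0)) = b1 \<otimes> a1 \<otimes> b2 \<otimes> a2" "lam (\<one>, (0, 1)) = inv a2 \<otimes> inv b2"
    using gens uv by (simp_all add: lam \<phi>0 \<phi>_gens) (simp_all add: u v)
  moreover have "lam \<in> iso (sdprod F int_sdprod \<theta>) P" "\<gamma> \<in> iso P (sdprod F int_sdprod \<theta>)"
    using isos group_isomorphisms_imp_iso group_isomorphisms_sym by blast+
  moreover have "\<forall>x\<in>carrier (sdprod F int_sdprod \<theta>). \<gamma> (lam x) = x" "\<forall>g\<in>carrier P. lam (\<gamma> g) = g"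
    using isos by (simp_all add: group_isomorphisms_def)
  moreover have "\<theta> \<in> hom int_sdprod (AutoGroup F)"
    using E.section_action_hom by (simp only: F_eq \<theta>_eq)
  moreover have "\<theta> (m, n) u = B [^] (m - odd_delta n) \<otimes> u [^] alt_sign n \<otimes> B [^] (- m + odd_delta n)"
      "\<theta> (m, n) v = B [^] m \<otimes> v \<otimes> u [^] (- 2 * m) \<otimes> B [^] (- m + odd_delta n)"
      "\<theta> (m, n) B = B [^] alt_sign n" for m n
    using conj [of m n] gens by (simp_all only: \<theta>_conj uvF BF P.m_closed)
  ultimately show ?thesis using basis by blast
qed

end
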